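(* Let $N=2^k$, $[N]$ identified with $\mathbb F_2^k$ under $\oplus$, and let $V$ be a finite set with, for every $v\in V$, an orthonormal basis $\{v_i\}_{i\in[N]}$ of $\mathbb R^N$, such that (a) $1+\langle u_i,v_j\rangle\ge\langle u_i,w_\ell\rangle+\langle v_j,w_\ell\rangle$ for all $u,v,w\in V$ and $i,j,\ell\in[N]$, and (b) $\langle v_i,w_j\rangle=\langle v_{i\oplus\ell},w_{j\oplus\ell}\rangle$ for all $v,w\in V$, $i,j,\ell\in[N]$. For $v\in V$, $x\in\{-1,1\}^N$ let $\mathbf V_{v,x}=\frac1{\sqrt N}\sum_{i\in[N]}x_iv_i^{\otimes8}$ and $t=2^{240}+1$. Then the unit vectors $\{\mathbf V_{v,x}^{\otimes t}\}$ define a negative-type metric: for all $(u,x),(v,y),(w,z)$, $$\|\mathbf V_{u,x}^{\otimes t}-\mathbf V_{v,y}^{\otimes t}\|^2+\|\mathbf V_{v,y}^{\otimes t}-\mathbf V_{w,z}^{\otimes t}\|^2\ge\|\mathbf V_{u,x}^{\otimes t}-\mathbf V_{w,z}^{\otimes t}\|^2.$$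
   Context: For a vertex named $v$ (resp. $u,w$) its basis vectors are written $v_i$ (resp. $u_i,w_i$). $a^{\otimes m}$ is the $m$-fold tensor power, with $\langle a^{\otimes m},b^{\otimes m}\rangle=\langle a,b\rangle^m$. In the paper these hypotheses are the properties of the vector solution of its Unique Games integrality gap instance. *)

theory Defs
  imports "HOL-Analysis.Analysis"
begin

definition orthonormal_basis :: "'i set \<Rightarrow> ('i \<Rightarrow> real ^ 'n) \<Rightarrow> bool" where
  "orthonormal_basis I e \<longleftrightarrow>
     (\<forall>i\<in>I. \<forall>j\<in>I. e i \<bullet> e j = (if i = j then 1 else 0)) \<and> span (e ` I) = UNIV"

text \<open>
  The \<open>m\<close>-fold tensor power of a vector of \<open>\<real>\<^sup>n\<close>, in coordinates: the factors are indexed by a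
  finite type \<open>'m\<close> with \<open>m\<close> elements, so the coordinates of the tensor space
  are indexed by the functions \<open>'m \<Rightarrow> 'n\<close>, with \<open>m\<close> read off the result type;
  an exponent such as \<open>2 ^ 240 + 1\<close> is prescribed by an assumption on \<open>CARD('m)\<close>.
  The lemma after the definition is the expected formula for inner products.
\<close>

definition tensor_power :: "real ^ 'n \<Rightarrow> real ^ ('m::finite \<Rightarrow> 'n::finite)" where
  "tensor_power a = (\<chi> s. \<Prod>j\<in>UNIV. a $ s j)"

lemma inner_tensor_power:
  fixes a b :: "real ^ 'n"
  shows "(tensor_power a :: real ^ ('m::finite \<Rightarrow> 'n)) \<bullet> tensor_power b = (a \<bullet> b) ^ CARD('m)"
proof -
  have "(\<Prod>j\<in>(UNIV :: 'm set). \<Sum>i\<in>(UNIV :: 'n set). a $ i * b $ i)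
      = (\<Sum>s\<in>(UNIV :: ('m \<Rightarrow> 'n) set). \<Prod>j\<in>UNIV. a $ s j * b $ s j)"
    by (subst prod_sum_PiE) (auto simp: PiE_UNIV_domain)
  then show ?thesis
    by (simp add: tensor_power_def inner_vec_def prod.distrib)
qed

text \<open>
  The label set \<open>[N]\<close>, \<open>N = 2 ^ k\<close>, is \<open>{..<2 ^ k}\<close>; a label stands for the vector of its \<open>k\<close>
  binary digits, so that addition in \<open>\<bbbF>\<^sub>2\<^sup>k\<close> is bitwise exclusive or.
\<close>

definition cube_vector :: "nat \<Rightarrow> (nat \<Rightarrow> real ^ 'n) \<Rightarrow> (nat \<Rightarrow> real) \<Rightarrow> real ^ (8 \<Rightarrow> 'n::finite)" where
  "cube_vector k e x = (1 / sqrt (2 ^ k)) *\<^sub>R (\<Sum>i<2 ^ k. x i *\<^sub>R tensor_power (e i))"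

end

theory Submission
  imports Defs
begin

text \<open>
  By the matching property and Parseval, for labels \<open>i, j, l\<close> the numbers
  \<open>\<alpha> = \<langle>u\<^sub>i, w\<^sub>l\<rangle>\<close>, \<open>\<beta> = \<langle>v\<^sub>j, w\<^sub>l\<rangle>\<close>, \<open>\<gamma> = \<langle>u\<^sub>i, v\<^sub>j\<rangle>\<close> satisfy
  \<open>1 + s \<alpha> + t \<beta> + s t \<gamma> \<ge> 0\<close> for all signs \<open>s, t\<close>: four times the left-hand side is a sum of squares.
  Hence \<open>1 - \<bar>\<cdot>\<bar>\<close> obeys all triangle inequalities, and so does \<open>1 - c\<close> for the correlations \<open>c\<close>
  of the sign vectors.

  An inner product \<open>A\<close> of two of the vectors \<open>\<^bold>V\<close> is \<open>\<Sum>\<^sub>m a\<^sub>m\<^sup>8 c\<^sub>m\<close> with \<open>\<Sum>\<^sub>m a\<^sub>m\<^sup>2 = 1\<close> and \<open>\<bar>c\<^sub>m\<bar> \<le> 1\<close>.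
  If \<open>A\<close> is close to 1, one index dominates, and then the other two inner products differ by at most
  \<open>3 (1 - A)\<close>. If two inner products \<open>A\<close>, \<open>B\<close> are close to 1, the third one satisfies
  \<open>A + B \<le> 1 + C\<close> exactly: the dominant terms gain a multiple of the product of the two defects,
  which absorbs the tails. The huge odd power makes inner products that are not close to \<open>\<plusminus>1\<close>
  negligible, so these two facts suffice.
\<close>

section \<open>Power inequalities\<close>

text \<open>Convexity of the power function: the pair \<open>1\<close>, \<open>a + b - 1\<close> has
  the same sum as \<open>a\<close>, \<open>b\<close> and is spread more widely.\<close>

lemma convex_power_le:
  fixes a b :: real
  assumes "0 \<le> a" "a \<le> 1" "0 \<le> b" "b \<le> 1" "1 \<le> a + b"
  shows "a ^ n + b ^ n \<le> 1 + (a + b - 1) ^ n"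
proof (induction n)
  case (Suc n)
  have "0 \<le> (a + b - 1) * (1 + (a + b - 1) ^ n - a ^ n - b ^ n) + (1 - b) * (1 - a ^ n) + (1 - a) * (1 - b ^ n)"
    using assms Suc by (intro add_nonneg_nonneg mult_nonneg_nonneg) (auto simp: power_le_one)
  also have "\<dots> = 1 + (a + b - 1) ^ Suc n - a ^ Suc n - b ^ Suc n"
    by (simp add: algebra_simps)
  finally show ?case by simp
qed simp

text \<open>The terms discarded in the induction for \<open>convex_power_le\<close> are each at
  least \<open>(1 - a) * (1 - b)\<close> for these exponents. This gain pays for the tails in
  \<open>corr_triangle\<close>.\<close>

lemma convex_power_gain:
  fixes a b :: real
  assumes "0 \<le> a" "a \<le> 1" "0 \<le> b" "b \<le> 1" "1 \<le> a + b" "n \<ge> 2"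
  shows "a ^ n + b ^ n + 2 * (1 - a) * (1 - b) \<le> 1 + (a + b - 1) ^ n"
proof -
  define j where "j = n - 2"
  have n: "n = Suc (Suc j)" using \<open>n \<ge> 2\<close> by (simp add: j_def)
  have le: "x ^ Suc j \<le> x" if "0 \<le> x" "x \<le> 1" for x :: real
    using that by (simp add: mult_left_le power_le_one)
  have "0 \<le> (a + b - 1) * (1 + (a + b - 1) ^ Suc j - a ^ Suc j - b ^ Suc j)"
    using assms convex_power_le[of a b "Suc j"] by (intro mult_nonneg_nonneg) auto
  moreover have "(1 - b) * (1 - a) \<le> (1 - b) * (1 - a ^ Suc j)"
    using assms le[of a] by (intro mult_left_mono) auto
  moreover have "(1 - a) * (1 - b) \<le> (1 - a) * (1 - b ^ Suc j)"
    using assms le[of b] by (intro mult_left_mono) auto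
  moreover have "(a + b - 1) * (1 + (a + b - 1) ^ Suc j - a ^ Suc j - b ^ Suc j) + (1 - b) * (1 - a ^ Suc j)
     + (1 - a) * (1 - b ^ Suc j) = 1 + (a + b - 1) ^ n - a ^ n - b ^ n"
    by (simp add: algebra_simps n)
  moreover have "2 * (1 - a) * (1 - b) = (1 - b) * (1 - a) + (1 - a) * (1 - b)"
    by (simp add: algebra_simps)
  ultimately show ?thesis by linarith
qed

text \<open>After factoring out \<open>x - y\<close>, each of the \<open>Suc n\<close> remaining
  summands is at most \<open>x ^ n\<close>.\<close>

lemma power_diff_le:
  fixes x y :: real
  assumes "0 \<le> y" "y \<le> x"
  shows "x ^ Suc n - y ^ Suc n \<le> real (Suc n) * (x - y) * x ^ n"
proof -
  have "(\<Sum>i<Suc n. x ^ i * y ^ (n - i)) \<le> (\<Sum>i<Suc n. x ^ n)"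
  proof (rule sum_mono)
    fix i assume i: "i \<in> {..<Suc n}"
    have "x ^ i * y ^ (n - i) \<le> x ^ i * x ^ (n - i)"
      using assms by (intro mult_left_mono power_mono) auto
    with i show "x ^ i * y ^ (n - i) \<le> x ^ n" by (simp flip: power_add)
  qed
  then have "(x - y) * (\<Sum>i<Suc n. x ^ i * y ^ (n - i)) \<le> (x - y) * (real (Suc n) * x ^ n)"
    using assms by (intro mult_left_mono) auto
  then show ?thesis
    using power_diff_sumr2[of x "Suc n" y] by (simp add: mult_ac del: sum.lessThan_Suc power_Suc)
qed

text \<open>Even exponents suit \<open>kernel_tail\<close>, which makes sums of sixth powers
  quadratically small; adding both sixth powers avoids deciding which of \<open>x\<close>,
  \<open>y\<close> is larger.\<close>

lemma power8_diff_le: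
  fixes x y :: real
  assumes "0 \<le> x" "x \<le> 1" "0 \<le> y" "y \<le> 1"
  shows "\<bar>x ^ 8 - y ^ 8\<bar> \<le> 8 * \<bar>x - y\<bar> * (x ^ 6 + y ^ 6)"
proof -
  have *: "\<bar>x ^ 8 - y ^ 8\<bar> \<le> 8 * \<bar>x - y\<bar> * (x ^ 6 + y ^ 6)"
    if "0 \<le> y" "y \<le> x" "x \<le> 1" for x y :: real
  proof -
    have "x ^ 7 \<le> x ^ 6" using that by (intro power_decreasing) auto
    also have "\<dots> \<le> x ^ 6 + y ^ 6" by simp
    finally have "8 * (x - y) * x ^ 7 \<le> 8 * (x - y) * (x ^ 6 + y ^ 6)"
      using that by (intro mult_left_mono) auto
    moreover have "y ^ 8 \<le> x ^ 8" using that by (intro power_mono) auto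
    ultimately show ?thesis using power_diff_le[of y x 7] that by simp
  qed
  show ?thesis
    using *[of x y] *[of y x] assms by (cases "x \<le> y") (auto simp: abs_minus_commute add.commute)
qed

section \<open>Eighth-power correlations with a dominant term\<close>

text \<open>In the application \<open>a\<close> holds absolute overlaps of two bases and
  \<open>c\<close> correlations of two sign vectors; \<open>corr\<close> is then the inner product
  of the two cube vectors.\<close>

definition kernel :: "'i set \<Rightarrow> ('i \<Rightarrow> real) \<Rightarrow> ('i \<Rightarrow> real) \<Rightarrow> bool" where
  "kernel I a c \<longleftrightarrow> finite I \<and> (\<forall>m\<in>I. 0 \<le> a m \<and> \<bar>c m\<bar> \<le> 1) \<and> (\<Sum>m\<in>I. (a m)\<^sup>2) = 1"

definition corr :: "'i set \<Rightarrow> ('i \<Rightarrow> real) \<Rightarrow> ('i \<Rightarrow> real) \<Rightarrow> real" where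
  "corr I a c = (\<Sum>m\<in>I. a m ^ 8 * c m)"

lemma kernel_le_one:
  assumes "kernel I a c" "m \<in> I"
  shows "a m \<le> 1"
proof -
  have "(a m)\<^sup>2 \<le> (\<Sum>m\<in>I. (a m)\<^sup>2)"
    using assms by (intro member_le_sum) (auto simp: kernel_def)
  then show ?thesis using assms by (simp add: kernel_def abs_square_le_1)
qed

text \<open>The squares outside \<open>p\<close> sum to \<open>1 - (a p)\<^sup>2\<close>, so each of
  them is at most that; all but one of the squares in a higher even power are estimated this
  way.\<close>

lemma kernel_tail:
  assumes K: "kernel I a c" and p: "p \<in> I"
  shows "(\<Sum>m\<in>I - {p}. a m ^ 6) \<le> (1 - (a p)\<^sup>2) ^ 2"
    and "(\<Sum>m\<in>I - {p}. a m ^ 8) \<le> (1 - (a p)\<^sup>2) ^ 3"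
proof -
  let ?r = "1 - (a p)\<^sup>2"
  have s: "(\<Sum>m\<in>I - {p}. (a m)\<^sup>2) = ?r"
    using K p by (simp add: kernel_def sum_diff1)
  have r: "0 \<le> ?r" by (simp flip: s add: sum_nonneg)
  have le: "(a m)\<^sup>2 \<le> ?r" if "m \<in> I - {p}" for m
    unfolding s[symmetric] using that K by (intro member_le_sum) (auto simp: kernel_def)
  have g: "(\<Sum>m\<in>I - {p}. a m ^ (2 * j + 2)) \<le> ?r ^ j" for j
  proof -
    have "(\<Sum>m\<in>I - {p}. a m ^ (2 * j + 2)) \<le> (\<Sum>m\<in>I - {p}. ?r ^ j * (a m)\<^sup>2)"
    proof (rule sum_mono)
      fix m assume m: "m \<in> I - {p}"
      have "a m ^ (2 * j + 2) = ((a m)\<^sup>2) ^ j * (a m)\<^sup>2" by (simp only: power_add power_mult)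
      also have "\<dots> \<le> ?r ^ j * (a m)\<^sup>2" using le[OF m] by (intro mult_right_mono power_mono) auto
      finally show "a m ^ (2 * j + 2) \<le> ?r ^ j * (a m)\<^sup>2" .
    qed
    also have "\<dots> = ?r ^ j * ?r" by (simp add: s flip: sum_distrib_left)
    also have "\<dots> \<le> ?r ^ j" using r by (intro mult_left_le) auto
    finally show ?thesis .
  qed
  show "(\<Sum>m\<in>I - {p}. a m ^ 6) \<le> ?r ^ 2" "(\<Sum>m\<in>I - {p}. a m ^ 8) \<le> ?r ^ 3"
    using g[of 2] g[of 3] by simp_all
qed

lemma kernel_sum_le_one:
  assumes "kernel I a c" "n \<ge> 2"
  shows "(\<Sum>m\<in>I. a m ^ n) \<le> 1"
proof -
  have "(\<Sum>m\<in>I. a m ^ n) \<le> (\<Sum>m\<in>I. (a m)\<^sup>2)"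
    using assms kernel_le_one[OF assms(1)] by (intro sum_mono power_decreasing) (auto simp: kernel_def)
  then show ?thesis using assms by (simp add: kernel_def)
qed

lemma corr_split:
  assumes K: "kernel I a c" and p: "p \<in> I"
  shows "corr I a c = a p ^ 8 * c p + (\<Sum>m\<in>I - {p}. a m ^ 8 * c m)"
    and "(\<Sum>m\<in>I - {p}. a m ^ 8 * c m) \<le> (1 - (a p)\<^sup>2) ^ 3"
proof -
  show "corr I a c = a p ^ 8 * c p + (\<Sum>m\<in>I - {p}. a m ^ 8 * c m)"
    using K p by (simp add: kernel_def corr_def sum.remove)
  have "(\<Sum>m\<in>I - {p}. a m ^ 8 * c m) \<le> (\<Sum>m\<in>I - {p}. a m ^ 8)"
    using K by (intro sum_mono mult_left_le) (auto simp: kernel_def abs_le_iff)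
  with kernel_tail(2)[OF K p] show "(\<Sum>m\<in>I - {p}. a m ^ 8 * c m) \<le> (1 - (a p)\<^sup>2) ^ 3" by simp
qed

text \<open>If \<open>p\<close> maximizes \<open>a\<close>, then the correlation is at most
  \<open>a p ^ 6\<close> times the sum of squares, which is 1. So \<open>a p\<close> is close to 1,
  the tail is cubically small, and the main term forces \<open>c p\<close> close to 1.\<close>

lemma kernel_dominant:
  assumes K: "kernel I a c" and A: "corr I a c \<ge> 1 - 1 / 1000"
  obtains p where "p \<in> I" "a p \<ge> 1 - 1 / 1000" "c p \<ge> 1 - 1 / 500"
proof -
  have ne: "finite I" "I \<noteq> {}" using K by (auto simp: kernel_def)
  have "Max (a ` I) \<in> a ` I" using ne by (intro Max_in) auto
  then obtain p where p: "p \<in> I" and "a p = Max (a ` I)" by auto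
  then have max: "a m \<le> a p" if "m \<in> I" for m using ne that by simp
  have a: "0 \<le> a p" "a p \<le> 1" using K p kernel_le_one[OF K p] by (auto simp: kernel_def)
  have "corr I a c \<le> (\<Sum>m\<in>I. a p ^ 6 * (a m)\<^sup>2)"
    unfolding corr_def
  proof (rule sum_mono)
    fix m assume m: "m \<in> I"
    have "a m ^ 8 * c m \<le> a m ^ 8" using K m by (intro mult_left_le) (auto simp: kernel_def abs_le_iff)
    also have "\<dots> = a m ^ 6 * (a m)\<^sup>2" by (simp flip: power_add)
    also have "\<dots> \<le> a p ^ 6 * (a m)\<^sup>2"
      using K m max[OF m] by (intro mult_right_mono power_mono) (auto simp: kernel_def)
    finally show "a m ^ 8 * c m \<le> a p ^ 6 * (a m)\<^sup>2" .
  qed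
  also have "\<dots> = a p ^ 6" using K by (simp add: kernel_def flip: sum_distrib_left)
  also have "\<dots> \<le> a p" using a power_decreasing[of 1 6 "a p"] by simp
  finally have ap: "1 - 1 / 1000 \<le> a p" using A by simp
  have "(1 - 1 / 1000)\<^sup>2 \<le> (a p)\<^sup>2" using ap by (intro power_mono) auto
  then have r: "0 \<le> 1 - (a p)\<^sup>2" "1 - (a p)\<^sup>2 \<le> 1 / 500"
    using a by (auto simp: power2_eq_square mult_le_one)
  have "(1 - (a p)\<^sup>2) ^ 3 \<le> (1 / 500) ^ 3" using r by (intro power_mono) auto
  then have m: "a p ^ 8 * c p \<ge> 1 - 1 / 500"
    using corr_split[OF K p] A by (simp add: power3_eq_cube)
  \<comment> \<open>The sign matters: only for nonnegative \<open>c p\<close> does dropping the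
    factor \<open>a p ^ 8\<close> increase the product.\<close>
  have "c p > 0"
  proof (rule ccontr)
    assume "\<not> 0 < c p"
    then have "a p ^ 8 * c p \<le> 0" using a by (intro mult_nonneg_nonpos) auto
    with m show False by simp
  qed
  then have "a p ^ 8 * c p \<le> c p" using a by (intro mult_left_le_one_le) (auto simp: power_le_one)
  with m have "c p \<ge> 1 - 1 / 500" by simp
  with p ap show ?thesis using that by blast
qed

text \<open>A discrete product rule. The subset \<open>S\<close> is the whole index set in
  \<open>corr_lipschitz\<close>, and the complement of the dominant index, where the sums on the
  right are small, in \<open>corr_triangle\<close>.\<close>

lemma kernel_diff:
  assumes K: "kernel I a c" "kernel I g e" and S: "S \<subseteq> I"
    and d: "\<And>m. m \<in> I \<Longrightarrow> \<bar>a m - g m\<bar> \<le> d" and h: "\<And>m. m \<in> I \<Longrightarrow> \<bar>c m - e m\<bar> \<le> h"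
  shows "\<bar>(\<Sum>m\<in>S. a m ^ 8 * c m) - (\<Sum>m\<in>S. g m ^ 8 * e m)\<bar>
    \<le> 8 * d * ((\<Sum>m\<in>S. a m ^ 6) + (\<Sum>m\<in>S. g m ^ 6)) + h * (\<Sum>m\<in>S. g m ^ 8)"
proof -
  have "\<bar>a m ^ 8 * c m - g m ^ 8 * e m\<bar> \<le> 8 * d * (a m ^ 6 + g m ^ 6) + h * g m ^ 8"
    if "m \<in> S" for m
  proof -
    have m: "m \<in> I" using that S by auto
    have b: "0 \<le> a m" "a m \<le> 1" "0 \<le> g m" "g m \<le> 1" "\<bar>c m\<bar> \<le> 1"
      using K m kernel_le_one[OF K(1) m] kernel_le_one[OF K(2) m] by (auto simp: kernel_def)
    have "\<bar>a m ^ 8 * c m - g m ^ 8 * e m\<bar> = \<bar>(a m ^ 8 - g m ^ 8) * c m + g m ^ 8 * (c m - e m)\<bar>"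
      by (simp add: algebra_simps)
    also have "\<dots> \<le> \<bar>a m ^ 8 - g m ^ 8\<bar> * \<bar>c m\<bar> + g m ^ 8 * \<bar>c m - e m\<bar>"
      by (rule order_trans[OF abs_triangle_ineq]) (simp add: abs_mult)
    also have "\<dots> \<le> \<bar>a m ^ 8 - g m ^ 8\<bar> + g m ^ 8 * h"
      using b h[OF m] by (intro add_mono mult_left_le mult_left_mono) auto
    also have "\<bar>a m ^ 8 - g m ^ 8\<bar> \<le> 8 * \<bar>a m - g m\<bar> * (a m ^ 6 + g m ^ 6)"
      using b by (intro power8_diff_le)
    also have "\<dots> \<le> 8 * d * (a m ^ 6 + g m ^ 6)"
      using b d[OF m] by (intro mult_right_mono mult_left_mono add_nonneg_nonneg) auto
    finally show ?thesis by (simp add: mult.commute)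
  qed
  then have "(\<Sum>m\<in>S. \<bar>a m ^ 8 * c m - g m ^ 8 * e m\<bar>) \<le> (\<Sum>m\<in>S. 8 * d * (a m ^ 6 + g m ^ 6) + h * g m ^ 8)"
    by (rule sum_mono)
  then show ?thesis
    using sum_abs[of "\<lambda>m. a m ^ 8 * c m - g m ^ 8 * e m" S]
    by (simp add: sum.distrib sum_subtractf flip: sum_distrib_left)
qed

lemma power8_bounds:
  fixes a :: real
  assumes "1 - 1 / 1000 \<le> a" "a \<le> 1"
  shows "a ^ 8 \<ge> 9 / 10" "1 - a\<^sup>2 \<le> 2 * (1 - a)" "0 \<le> 1 - a\<^sup>2"
proof -
  have "(1 - 1 / 1000) ^ 8 \<le> a ^ 8" using assms by (intro power_mono) auto
  moreover have "(9 / 10 :: real) \<le> (1 - 1 / 1000) ^ 8" by (simp add: power_divide)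
  ultimately show "a ^ 8 \<ge> 9 / 10" by linarith
  have "0 \<le> (1 - a)\<^sup>2" by simp
  then show "1 - a\<^sup>2 \<le> 2 * (1 - a)" by (simp add: power2_eq_square algebra_simps)
  show "0 \<le> 1 - a\<^sup>2" using assms by (simp add: power_le_one)
qed

text \<open>The difference is at most \<open>16 * (1 - a p) + (1 - c p)\<close>, while the defect of
  the dominant correlation is at least \<open>6 * (1 - a p) + 9 / 10 * (1 - c p)\<close>; three
  times the latter exceeds the former.\<close>

lemma corr_lipschitz:
  assumes K: "kernel I a c" and p: "p \<in> I" "a p \<ge> 1 - 1 / 1000" "c p \<ge> 1 - 1 / 500"
    and L: "kernel I f d" "kernel I g e"
    and d: "\<And>m. m \<in> I \<Longrightarrow> \<bar>f m - g m\<bar> \<le> 1 - a p" and h: "\<And>m. m \<in> I \<Longrightarrow> \<bar>d m - e m\<bar> \<le> 1 - c p"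
  shows "\<bar>corr I f d - corr I g e\<bar> \<le> 3 * (1 - corr I a c)"
proof -
  have ap: "0 \<le> 1 - a p" "a p \<le> 1" and cp: "0 \<le> 1 - c p" "c p \<le> 1"
    using K p kernel_le_one[OF K p(1)] by (auto simp: kernel_def abs_le_iff)
  have "\<bar>corr I f d - corr I g e\<bar> \<le> 8 * (1 - a p) * ((\<Sum>m\<in>I. f m ^ 6) + (\<Sum>m\<in>I. g m ^ 6)) + (1 - c p) * (\<Sum>m\<in>I. g m ^ 8)"
    unfolding corr_def using kernel_diff[OF L _ d h, of I] by simp
  also have "\<dots> \<le> 8 * (1 - a p) * (1 + 1) + (1 - c p) * 1"
    using L ap cp by (intro add_mono mult_left_mono kernel_sum_le_one) auto
  finally have 1: "\<bar>corr I f d - corr I g e\<bar> \<le> 16 * (1 - a p) + (1 - c p)" by simp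
  note P = power8_bounds[OF p(2) ap(2)]
  define x where "x = 1 - a p"
  have x: "0 \<le> x" "x \<le> 1 / 1000" using ap p by (auto simp: x_def)
  have "corr I a c \<le> a p ^ 8 * c p + (1 - (a p)\<^sup>2) ^ 3"
    using corr_split[OF K p(1)] by simp
  also have "(1 - (a p)\<^sup>2) ^ 3 \<le> (2 * x) ^ 3"
    using P unfolding x_def by (intro power_mono) auto
  also have "(2 * x) ^ 3 = 8 * x * (x * x)" by (simp add: power3_eq_cube)
  also have "8 * x * (x * x) \<le> 8 * x * (1 / 1000)"
    using x mult_le_one[of x x] mult_mono[of x "1 / 1000" x 1] by (intro mult_left_mono) auto
  finally have 2: "corr I a c \<le> a p ^ 8 * c p + x * 8 / 1000" by simp
  \<comment> \<open>The geometric sum has eight terms, each at least 9/10, which gives slope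
    7.\<close>
  have pw: "a p ^ 8 \<le> 1 - 7 * x"
  proof -
    have "1 ^ Suc 7 - a p ^ Suc 7 = (1 - a p) * (\<Sum>i<8. a p ^ i)"
      using power_diff_1_eq[of "a p" 8] by (simp add: algebra_simps)
    moreover have "(\<Sum>i<8. a p ^ i) \<ge> (\<Sum>i<8::nat. 9 / 10 :: real)"
    proof (rule sum_mono)
      fix i :: nat assume "i \<in> {..<8}"
      then have "a p ^ 8 \<le> a p ^ i" using ap p by (intro power_decreasing) auto
      with P(1) show "9 / 10 \<le> a p ^ i" by simp
    qed
    then have "(1 - a p) * 7 \<le> (1 - a p) * (\<Sum>i<8. a p ^ i)"
      using ap by (intro mult_left_mono) auto
    ultimately show ?thesis by (simp add: x_def)
  qed
  have "(1 - c p) * (9 / 10) \<le> (1 - c p) * a p ^ 8" using P cp by (intro mult_left_mono) auto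
  then have 3: "a p ^ 8 * c p \<le> a p ^ 8 - (1 - c p) * (9 / 10)" by (simp add: algebra_simps)
  from 2 3 pw have "corr I a c \<le> 1 - 7 * x + x * 8 / 1000 - (1 - c p) * (9 / 10)" by linarith
  then have "corr I a c + 6 * x + (1 - c p) * (9 / 10) \<le> 1" using x(1) by (simp add: field_simps)
  then have "16 * x + (1 - c p) \<le> 3 * (1 - corr I a c)"
    using x(1) cp(1) by (simp add: field_simps)
  with 1 show ?thesis unfolding x_def by linarith
qed

text \<open>
  The main term gains \<open>2 x y + k x / 2\<close>, where \<open>x = 1 - a p\<close>, \<open>y = 1 - b q\<close>, \<open>k = 1 - d q\<close>. The tail of
  \<open>corr J b d\<close> is \<open>O(y\<^sup>3)\<close>. The other two tails need not be \<open>O(y)\<close> individually, but they belong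
  to kernels at distance at most \<open>y\<close> and \<open>k\<close>, so they nearly cancel; this uses \<open>y \<le> x\<close>.
\<close>

lemma corr_triangle:
  assumes K: "kernel I a c" "kernel J b d" "kernel I g e"
    and p: "p \<in> I" "a p \<ge> 1 - 1 / 1000" "c p \<ge> 1 - 1 / 500"
    and q: "q \<in> J" "b q \<ge> 1 - 1 / 1000" "d q \<ge> 1 - 1 / 500"
    and le: "a p \<le> b q"
    and gp: "a p + b q \<le> 1 + g p" and ep: "c p + d q \<le> 1 + e p"
    and dist: "\<And>m. m \<in> I \<Longrightarrow> \<bar>a m - g m\<bar> \<le> 1 - b q" "\<And>m. m \<in> I \<Longrightarrow> \<bar>c m - e m\<bar> \<le> 1 - d q"
  shows "corr I a c + corr J b d \<le> 1 + corr I g e"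
proof -
  define x y h k where "x = 1 - a p" "y = 1 - b q" "h = 1 - c p" "k = 1 - d q"
  note defs = this
  have ap: "0 \<le> a p" "a p \<le> 1" and cp: "c p \<le> 1" and bq: "0 \<le> b q" "b q \<le> 1" and dq: "d q \<le> 1"
    and gp1: "0 \<le> g p" "g p \<le> 1"
    using K p q kernel_le_one[OF K(1) p(1)] kernel_le_one[OF K(2) q(1)] kernel_le_one[OF K(3) p(1)]
    by (auto simp: kernel_def abs_le_iff)
  have x: "0 \<le> y" "y \<le> x" "x \<le> 1 / 1000" "0 \<le> h" "h \<le> 1 / 500" "0 \<le> k" "k \<le> 1 / 500"
    using ap bq cp dq p q le by (auto simp: defs)
  have xx: "x * x \<le> x / 1000" using mult_left_mono[of x "1/1000" x] x by simp
  have yy: "y * y \<le> x / 1000" using mult_mono[of y x y x] x xx by linarith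
  note P = power8_bounds[OF p(2) ap(2)] and Q = power8_bounds[OF q(2) bq(2)]
  let ?S = "I - {p}"
  define TA TG where "TA = (\<Sum>m\<in>?S. a m ^ 8 * c m)" "TG = (\<Sum>m\<in>?S. g m ^ 8 * e m)"
  note T = this
  \<comment> \<open>The distance of \<open>g p\<close> from 1 is at most \<open>x + y\<close>, hence
    at most \<open>2 * x\<close>.\<close>
  have gr: "0 \<le> 1 - (g p)\<^sup>2" "1 - (g p)\<^sup>2 \<le> 4 * x"
  proof -
    show "0 \<le> 1 - (g p)\<^sup>2" using gp1 by (simp add: power_le_one)
    have "0 \<le> (1 - g p)\<^sup>2" by simp
    then have "1 - (g p)\<^sup>2 \<le> 2 * (1 - g p)" by (simp add: power2_eq_square algebra_simps)
    then show "1 - (g p)\<^sup>2 \<le> 4 * x" using gp x by (simp add: defs)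
  qed
  have sa: "(\<Sum>m\<in>?S. a m ^ 6) \<le> 4 * (x / 1000)"
  proof -
    have "(1 - (a p)\<^sup>2) ^ 2 \<le> (2 * x)\<^sup>2" using P by (intro power_mono) (auto simp: defs)
    then show ?thesis using kernel_tail(1)[OF K(1) p(1)] xx by (simp add: power2_eq_square)
  qed
  have sg: "(\<Sum>m\<in>?S. g m ^ 6) \<le> 16 * (x / 1000)"
  proof -
    have "(1 - (g p)\<^sup>2) ^ 2 \<le> (4 * x)\<^sup>2" using gr by (intro power_mono) (auto simp: defs)
    then show ?thesis using kernel_tail(1)[OF K(3) p(1)] xx by (simp add: power2_eq_square)
  qed
  have sg8: "(\<Sum>m\<in>?S. g m ^ 8) \<le> x / 10"
  proof -
    have "(1 - (g p)\<^sup>2) ^ 3 \<le> (4 * x) ^ 3" using gr by (intro power_mono) (auto simp: defs)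
    also have "(4 * x) ^ 3 = 64 * x * (x * x)" by (simp add: power3_eq_cube)
    also have "\<dots> \<le> 64 * x * (1 / 1000)" using xx x by (intro mult_left_mono) auto
    finally show ?thesis using kernel_tail(2)[OF K(3) p(1)] x by simp
  qed
  have "\<bar>TA - TG\<bar> \<le> 8 * y * ((\<Sum>m\<in>?S. a m ^ 6) + (\<Sum>m\<in>?S. g m ^ 6)) + k * (\<Sum>m\<in>?S. g m ^ 8)"
    unfolding T defs using dist by (intro kernel_diff[OF K(1,3)]) auto
  also have "\<dots> \<le> 8 * y * (4 * (x / 1000) + 16 * (x / 1000)) + k * (x / 10)"
    using x sa sg sg8 by (intro add_mono mult_left_mono) auto
  finally have tail: "TA - TG \<le> x * y * (16 / 100) + k * x / 10" by (simp add: algebra_simps)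
  have A: "corr I a c = a p ^ 8 * c p + TA" unfolding T using corr_split(1)[OF K(1) p(1)] .
  have G: "corr I g e = g p ^ 8 * e p + TG" unfolding T using corr_split(1)[OF K(3) p(1)] .
  have "corr J b d \<le> b q ^ 8 * d q + (1 - (b q)\<^sup>2) ^ 3"
    using corr_split[OF K(2) q(1)] by simp
  also have "(1 - (b q)\<^sup>2) ^ 3 \<le> (2 * y) ^ 3"
    using Q unfolding defs by (intro power_mono) auto
  also have "(2 * y) ^ 3 = 8 * y * (y * y)" by (simp add: power3_eq_cube)
  also have "\<dots> \<le> 8 * y * (x / 1000)" using x yy by (intro mult_left_mono) auto
  finally have B: "corr J b d \<le> b q ^ 8 * d q + x * y * 8 / 1000" by (simp add: algebra_simps)
  \<comment> \<open>\<open>w\<close> is the lower bound for \<open>g p\<close> from the triangle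
    inequality; it also equals \<open>b q - x\<close>.\<close>
  define w where "w = a p + b q - 1"
  have w: "0 \<le> w" "w \<le> a p" "w \<le> g p" "w \<le> b q" using gp ap bq p q by (auto simp: w_def)
  have "w ^ 8 * (1 - h - k) \<le> g p ^ 8 * e p"
    using w ep x by (intro mult_mono power_mono) (auto simp: defs)
  moreover have "a p ^ 8 + b q ^ 8 + 2 * x * y \<le> 1 + w ^ 8"
    unfolding w_def defs using p q ap bq by (intro convex_power_gain) auto
  moreover have "h * w ^ 8 \<le> h * a p ^ 8" using w x by (intro mult_left_mono power_mono) auto
  \<comment> \<open>The weight \<open>k\<close> multiplies \<open>b q ^ 8\<close> on the left but
    only \<open>w ^ 8\<close> on the right; since \<open>w = b q - x\<close>, the surplus is at
    least \<open>x * b q ^ 7\<close>.\<close>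
  moreover have "k * x / 2 \<le> k * (b q ^ 8 - w ^ 8)"
  proof -
    have "b q ^ 7 \<ge> b q ^ 8" using bq by (intro power_decreasing) auto
    then have "x * (1 / 2) \<le> x * b q ^ 7" using Q x by (intro mult_left_mono) auto
    also have "\<dots> = b q ^ 8 - w * b q ^ 7" by (simp add: w_def defs algebra_simps eval_nat_numeral)
    also have "\<dots> \<le> b q ^ 8 - w * w ^ 7" using w by (intro diff_left_mono mult_left_mono power_mono) auto
    also have "w * w ^ 7 = w ^ 8" by (simp add: eval_nat_numeral)
    finally have "k * (x * (1 / 2)) \<le> k * (b q ^ 8 - w ^ 8)" using x by (intro mult_left_mono) auto
    then show ?thesis by simp
  qed
  moreover have "a p ^ 8 * c p = a p ^ 8 - h * a p ^ 8" "b q ^ 8 * d q = b q ^ 8 - k * b q ^ 8"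
    "w ^ 8 * (1 - h - k) = w ^ 8 - h * w ^ 8 - k * w ^ 8"
    by (simp_all add: defs algebra_simps)
  moreover have "0 \<le> x * y" "0 \<le> k * x" using x by auto
  ultimately show ?thesis using A B G tail by (simp add: algebra_simps)
qed

section \<open>Triples of kernels on the cube\<close>

text \<open>Kernels are indexed by differences of labels. If a third label differs from two others
  by \<open>p\<close> and \<open>q\<close>, those two differ by \<open>xor p q\<close>; the
  conditions are the triangle inequalities for one minus the entries.\<close>

definition cube_triangle :: "nat \<Rightarrow> (nat \<Rightarrow> real) \<Rightarrow> (nat \<Rightarrow> real) \<Rightarrow> (nat \<Rightarrow> real) \<Rightarrow> bool" where
  "cube_triangle k f g h \<longleftrightarrow> (\<forall>p<2 ^ k. \<forall>q<2 ^ k.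
     f p + g q \<le> 1 + h (xor p q) \<and> f p + h (xor p q) \<le> 1 + g q \<and> g q + h (xor p q) \<le> 1 + f p)"

lemma xor_less_power2: "i < 2 ^ k \<Longrightarrow> j < 2 ^ k \<Longrightarrow> xor i j < (2 ^ k :: nat)"
  by (metis take_bit_nat_eq_self_iff take_bit_xor)

lemma xor_xor_cancel [simp]: "xor (xor i j) j = (i :: nat)" "xor j (xor j i) = (i :: nat)"
  by (simp_all add: xor.assoc flip: xor.assoc[of j j])

lemma bij_betw_xor: "j < 2 ^ k \<Longrightarrow> bij_betw (\<lambda>i. xor i j) {..<2 ^ k} {..<2 ^ k :: nat}"
  by (rule bij_betw_byWitness[where f' = "\<lambda>i. xor i j"]) (auto simp: xor_less_power2)

lemma sum_xor: "j < 2 ^ k \<Longrightarrow> (\<Sum>i<2 ^ k. f (xor i j)) = (\<Sum>i<2 ^ k :: nat. f i)"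
  by (rule sum.reindex_bij_betw[OF bij_betw_xor])

text \<open>Translating by a dominant label lines up the kernel of the third pair, entry by entry,
  with that of another pair.\<close>

lemma kernel_xor:
  fixes j :: nat
  assumes "kernel {..<2 ^ k} g e" "j < 2 ^ k"
  shows "kernel {..<2 ^ k} (\<lambda>m. g (xor m j)) (\<lambda>m. e (xor m j))"
    and "corr {..<2 ^ k} (\<lambda>m. g (xor m j)) (\<lambda>m. e (xor m j)) = corr {..<2 ^ k} g e"
  using assms sum_xor[OF assms(2), of "\<lambda>m. (g m)\<^sup>2"] sum_xor[OF assms(2), of "\<lambda>m. g m ^ 8 * e m"]
  by (auto simp: kernel_def corr_def xor_less_power2)

lemma cube_triangle_commute: "cube_triangle k f g h \<Longrightarrow> cube_triangle k g f h"
  unfolding cube_triangle_def by (metis xor.commute add.commute)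

lemma cube_triangle_dist:
  assumes "cube_triangle k f g h" "m < 2 ^ k" "q < 2 ^ k"
  shows "\<bar>f m - h (xor m q)\<bar> \<le> 1 - g q"
proof -
  have "f m + g q \<le> 1 + h (xor m q) \<and> g q + h (xor m q) \<le> 1 + f m"
    using assms by (auto simp: cube_triangle_def)
  then show ?thesis by linarith
qed

text \<open>Both dominant labels come from \<open>kernel_dominant\<close>. The pair with the smaller
  dominant overlap takes the first role in \<open>corr_triangle\<close>, and the third kernel is
  translated by the dominant label of the other pair.\<close>

lemma corr_near:
  assumes K: "kernel {..<2 ^ k} a c" "kernel {..<2 ^ k} b d" "kernel {..<2 ^ k} g e"
    and T: "cube_triangle k a b g" "cube_triangle k c d e"
    and large: "corr {..<2 ^ k} a c \<ge> 1 - 1 / 1000" "corr {..<2 ^ k} b d \<ge> 1 - 1 / 1000"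
  shows "corr {..<2 ^ k} a c + corr {..<2 ^ k} b d \<le> 1 + corr {..<2 ^ k} g e"
proof -
  obtain p where p: "p \<in> {..<2 ^ k}" "a p \<ge> 1 - 1 / 1000" "c p \<ge> 1 - 1 / 500"
    using kernel_dominant[OF K(1) large(1)] .
  obtain q where q: "q \<in> {..<2 ^ k}" "b q \<ge> 1 - 1 / 1000" "d q \<ge> 1 - 1 / 500"
    using kernel_dominant[OF K(2) large(2)] .
  have s: "a p + b q \<le> 1 + g (xor p q)" "c p + d q \<le> 1 + e (xor p q)"
    using T p(1) q(1) by (auto simp: cube_triangle_def)
  show ?thesis
  proof (cases "a p \<le> b q")
    case True
    have "corr {..<2 ^ k} a c + corr {..<2 ^ k} b d
      \<le> 1 + corr {..<2 ^ k} (\<lambda>m. g (xor m q)) (\<lambda>m. e (xor m q))"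
      using q(1) cube_triangle_dist[OF T(1)] cube_triangle_dist[OF T(2)] s True
      by (intro corr_triangle[OF K(1,2) kernel_xor(1)[OF K(3)] p q]) auto
    with kernel_xor(2)[OF K(3)] q(1) show ?thesis by simp
  next
    case False
    have "corr {..<2 ^ k} b d + corr {..<2 ^ k} a c
      \<le> 1 + corr {..<2 ^ k} (\<lambda>m. g (xor m p)) (\<lambda>m. e (xor m p))"
      using p(1) cube_triangle_dist[OF cube_triangle_commute[OF T(1)]]
        cube_triangle_dist[OF cube_triangle_commute[OF T(2)]] s False
      by (intro corr_triangle[OF K(2,1) kernel_xor(1)[OF K(3)] q p]) (auto simp: xor.commute)
    with kernel_xor(2)[OF K(3)] p(1) show ?thesis by simp
  qed
qed

lemma corr_far:
  assumes K: "kernel {..<2 ^ k} a c" "kernel {..<2 ^ k} b d" "kernel {..<2 ^ k} g e"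
    and T: "cube_triangle k a b g" "cube_triangle k c d e"
    and large: "corr {..<2 ^ k} a c \<ge> 1 - 1 / 1000"
  shows "\<bar>corr {..<2 ^ k} b d - corr {..<2 ^ k} g e\<bar> \<le> 3 * (1 - corr {..<2 ^ k} a c)"
proof -
  obtain p where p: "p \<in> {..<2 ^ k}" "a p \<ge> 1 - 1 / 1000" "c p \<ge> 1 - 1 / 500"
    using kernel_dominant[OF K(1) large(1)] .
  have "\<bar>corr {..<2 ^ k} b d - corr {..<2 ^ k} (\<lambda>m. g (xor m p)) (\<lambda>m. e (xor m p))\<bar>
      \<le> 3 * (1 - corr {..<2 ^ k} a c)"
    using p(1) cube_triangle_dist[OF cube_triangle_commute[OF T(1)]]
        cube_triangle_dist[OF cube_triangle_commute[OF T(2)]]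
    by (intro corr_lipschitz[OF K(1) p K(2) kernel_xor(1)[OF K(3)]]) auto
  with kernel_xor(2)[OF K(3)] p(1) show ?thesis by simp
qed

section \<open>The effect of the large odd power\<close>

text \<open>Bernoulli's inequality for the reciprocal alone gains only about a thousandth of the
  exponent, too little against the factor \<open>2 ^ 240\<close> that occurs later. It is therefore
  applied at \<open>2 ^ 238\<close> and the result is cubed.\<close>

lemma power_huge_le:
  fixes y :: real
  assumes "0 \<le> y" "y \<le> 1 - 1 / 1000"
  shows "y ^ 2 ^ 240 \<le> 1 / 2 ^ 300"
proof -
  let ?m = "2 ^ 238 :: nat"
  have "1 / 1000 * real ?m \<le> (1 + 1 / 1000) ^ ?m - 1"
    using Bernoulli_inequality[of "1/1000 :: real" ?m] by (simp add: mult.commute)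
  then have "2 ^ 100 \<le> (1 + 1 / 1000 :: real) ^ ?m" by simp
  moreover have "y ^ ?m * (1 + 1 / 1000) ^ ?m \<le> 1"
  proof -
    have "y * (1 + 1 / 1000) \<le> 1" using assms by simp
    then have "(y * (1 + 1 / 1000)) ^ ?m \<le> 1" using assms by (intro power_le_one) auto
    then show ?thesis by (simp only: power_mult_distrib)
  qed
  ultimately have "y ^ ?m * 2 ^ 100 \<le> 1"
    using mult_left_mono[of "2 ^ 100" "(1 + 1 / 1000 :: real) ^ ?m" "y ^ ?m"] assms
    by (meson order_trans zero_le_power)
  then have "y ^ ?m \<le> 1 / 2 ^ 100" by simp
  then have "(y ^ ?m) ^ 3 \<le> (1 / 2 ^ 100) ^ 3" using assms by (intro power_mono) auto
  moreover have "(y ^ ?m) ^ 3 = y ^ (?m * 3)" by (rule power_mult[symmetric])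
  moreover have "y ^ 2 ^ 240 \<le> y ^ (?m * 3)" using assms by (intro power_decreasing) auto
  ultimately show ?thesis by (simp add: power_divide)
qed

text \<open>The first power being at most -1/3 forces \<open>X\<close> close to -1. If another
  number is also close to -1, convexity finishes; otherwise the deficit of \<open>Y\<close> and
  \<open>Z\<close> is negligible against \<open>1 + X\<close>.\<close>

lemma odd_power_sum_nonneg:
  fixes X Y Z :: real
  assumes X: "X ^ (2 ^ 240 + 1) \<le> - 1 / 3"
    and bounds: "\<bar>X\<bar> \<le> 1" "\<bar>Y\<bar> \<le> 1" "\<bar>Z\<bar> \<le> 1"
    and XY: "X \<le> - (1 - 1 / 1000) \<Longrightarrow> Y \<le> - (1 - 1 / 1000) \<Longrightarrow> 0 \<le> 1 + X + Y + Z"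
    and XZ: "X \<le> - (1 - 1 / 1000) \<Longrightarrow> Z \<le> - (1 - 1 / 1000) \<Longrightarrow> 0 \<le> 1 + X + Y + Z"
    and far: "X \<le> - (1 - 1 / 1000) \<Longrightarrow> \<bar>Y + Z\<bar> \<le> 3 * (1 + X)"
  shows "0 \<le> 1 + X ^ (2 ^ 240 + 1) + Y ^ (2 ^ 240 + 1) + Z ^ (2 ^ 240 + 1)"
proof -
  define n :: nat where "n = 2 ^ 240"
  have n: "even n" "real n \<le> 2 ^ 240" by (simp_all add: n_def)
  have small: "y ^ n \<le> 1 / 2 ^ 300" if "0 \<le> y" "y \<le> 1 - 1 / 1000" for y :: real
    using power_huge_le[OF that] unfolding n_def .
  have neg: "(- y) ^ (n + 1) = - (y ^ (n + 1))" for y :: real using n by simp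
  have X': "X ^ (n + 1) \<le> - 1 / 3" using X unfolding n_def .
  have Xneg: "X \<le> - (1 - 1 / 1000)"
  proof (rule ccontr)
    assume "\<not> ?thesis"
    moreover have "X < 0"
    proof (rule ccontr)
      assume "\<not> X < 0"
      then have "0 \<le> X ^ (n + 1)" by (intro zero_le_power) simp
      with X' show False by linarith
    qed
    ultimately have "(- X) ^ n \<le> 1 / 2 ^ 300" using small[of "- X"] by auto
    moreover have "(- X) ^ (n + 1) \<le> (- X) ^ n"
      using \<open>X < 0\<close> bounds by (intro power_decreasing) auto
    ultimately show False using X' neg[of "X"] by simp
  qed
  \<comment> \<open>\<open>Y\<close> and \<open>Z\<close> play symmetric roles, so the smaller one
    is taken first.\<close>
  have main: "0 \<le> 1 + X ^ (n + 1) + Y ^ (n + 1) + Z ^ (n + 1)"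
    if Y: "\<bar>Y\<bar> \<le> 1" "\<bar>Z\<bar> \<le> 1" "Y \<le> Z" 
      and XY: "Y \<le> - (1 - 1 / 1000) \<Longrightarrow> 0 \<le> 1 + X + Y + Z"
      and far: "\<bar>Y + Z\<bar> \<le> 3 * (1 + X)" for Y Z :: real
  proof (cases "Y \<le> - (1 - 1 / 1000)")
    case True
    have "(- X) ^ (n + 1) + (- Y) ^ (n + 1) \<le> 1 + (- X + - Y - 1) ^ (n + 1)"
      using Xneg True Y bounds by (intro convex_power_le) auto
    also have "(- X + - Y - 1) ^ (n + 1) \<le> Z ^ (n + 1)"
      using XY[OF True] Xneg True by (intro power_mono) auto
    finally show ?thesis unfolding neg by simp
  next
    case False
    define \<epsilon> where "\<epsilon> = 1 + X"
    have \<epsilon>: "0 \<le> \<epsilon>" using bounds by (auto simp: \<epsilon>_def)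
    have "(- X) ^ (n + 1) \<le> (- X) ^ 1" using bounds Xneg by (intro power_decreasing) auto
    then have X1: "\<epsilon> \<le> 1 + X ^ (n + 1)" unfolding neg by (simp add: \<epsilon>_def)
    show ?thesis
    proof (cases "0 \<le> Y + Z")
      case True
      have "0 \<le> Y ^ (n + 1) + Z ^ (n + 1)"
      proof (cases "0 \<le> Y")
        case True then show ?thesis using Y by auto
      next
        case False
        then have "(- Y) ^ (n + 1) \<le> Z ^ (n + 1)" using \<open>0 \<le> Y + Z\<close> by (intro power_mono) auto
        then show ?thesis unfolding neg by simp
      qed
      then show ?thesis using X1 \<epsilon> by simp
    next
      case s: False
      have y: "0 \<le> - Y" "- Y \<le> 1 - 1 / 1000" using s Y False by auto
      \<comment> \<open>By \<open>far\<close>, \<open>Z\<close> is at least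
        \<open>- Y - 3 * \<epsilon>\<close>; truncating at 0 lets \<open>power_diff_le\<close>
        apply.\<close>
      define z where "z = max 0 (- Y - 3 * \<epsilon>)"
      have z: "0 \<le> z" "z \<le> - Y" "- Y - z \<le> 3 * \<epsilon>" using y \<epsilon> by (auto simp: z_def)
      show ?thesis
      proof (cases "0 \<le> Z")
        case True
        have "z ^ (n + 1) \<le> Z ^ (n + 1)"
          using z far True by (intro power_mono) (auto simp: z_def \<epsilon>_def)
        moreover have "(- Y) ^ (n + 1) - z ^ (n + 1) \<le> real (n + 1) * (- Y - z) * (- Y) ^ n"
          using power_diff_le[of z "- Y" n] z by simp
        moreover have "real (n + 1) * (- Y - z) * (- Y) ^ n \<le> (2 ^ 240 + 1) * (3 * \<epsilon>) * (1 / 2 ^ 300)"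
          using z y small[OF y] n \<epsilon> by (intro mult_mono) auto
        moreover have "(2 ^ 240 + 1) * (3 * \<epsilon>) * (1 / 2 ^ 300) \<le> \<epsilon>" using \<epsilon> by simp
        ultimately show ?thesis using X1 unfolding neg by linarith
      next
        case False
        have w: "0 \<le> - Z" "- Z \<le> 1 - 1 / 1000" using False Y y by auto
        \<comment> \<open>With both numbers negative, \<open>far\<close> bounds the sum of their
          absolute values, and the huge power shrinks it further.\<close>
        have "(- Y) * (- Y) ^ n \<le> (- Y) * (1 / 2 ^ 300)" "(- Z) * (- Z) ^ n \<le> (- Z) * (1 / 2 ^ 300)"
          using y w small by (intro mult_left_mono; simp)+
        then have "(- Y) ^ (n + 1) + (- Z) ^ (n + 1) \<le> (- Y - Z) * (1 / 2 ^ 300)"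
          by (simp add: algebra_simps)
        also have "\<dots> \<le> (3 * \<epsilon>) * (1 / 2 ^ 300)" using far by (intro mult_right_mono) (auto simp: \<epsilon>_def)
        also have "\<dots> \<le> \<epsilon>" using \<epsilon> by simp
        finally show ?thesis using X1 unfolding neg by linarith
      qed
    qed
  qed
  have "0 \<le> 1 + X ^ (n + 1) + Y ^ (n + 1) + Z ^ (n + 1)"
  proof (cases "Y \<le> Z")
    case True
    then show ?thesis using bounds XY far Xneg by (intro main) auto
  next
    case False
    then have "0 \<le> 1 + X ^ (n + 1) + Z ^ (n + 1) + Y ^ (n + 1)"
      using bounds XZ far Xneg by (intro main) (auto simp: add.commute add.left_commute)
    then show ?thesis by (simp add: add_ac)
  qed
  then show ?thesis unfolding n_def .
qed

text \<open>Closure under negation permits the symmetric form with plus signs. If the sum were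
  negative, one of the three powers would be at most -1/3, and symmetry makes it the first;
  \<open>near\<close> and \<open>far\<close> are used with the shared vector negated.\<close>

lemma odd_power_negative_type:
  fixes S :: "'a :: real_inner set"
  assumes unit: "\<And>p. p \<in> S \<Longrightarrow> norm p = 1" and neg: "\<And>p. p \<in> S \<Longrightarrow> - p \<in> S"
    and near: "\<And>p q r. \<lbrakk>p \<in> S; q \<in> S; r \<in> S; p \<bullet> r \<ge> 1 - 1 / 1000; q \<bullet> r \<ge> 1 - 1 / 1000\<rbrakk>
      \<Longrightarrow> p \<bullet> r + q \<bullet> r \<le> 1 + p \<bullet> q"
    and far: "\<And>p q r. \<lbrakk>p \<in> S; q \<in> S; r \<in> S; p \<bullet> r \<ge> 1 - 1 / 1000\<rbrakk>
      \<Longrightarrow> \<bar>q \<bullet> r - p \<bullet> q\<bar> \<le> 3 * (1 - p \<bullet> r)"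
    and S: "p \<in> S" "q \<in> S" "r \<in> S"
  shows "0 \<le> 1 + (p \<bullet> q) ^ (2 ^ 240 + 1) + (p \<bullet> r) ^ (2 ^ 240 + 1) + (q \<bullet> r) ^ (2 ^ 240 + 1)"
proof -
  define t :: nat where "t = 2 ^ 240 + 1"
  have b: "\<bar>p \<bullet> q\<bar> \<le> 1" if "p \<in> S" "q \<in> S" for p q
    using Cauchy_Schwarz_ineq2[of p q] unit that by simp
  have aux: "0 \<le> 1 + (p \<bullet> q) ^ t + (p \<bullet> r) ^ t + (q \<bullet> r) ^ t"
    if S: "p \<in> S" "q \<in> S" "r \<in> S" and X: "(p \<bullet> q) ^ t \<le> - 1 / 3" for p q r
    unfolding t_def
  proof (rule odd_power_sum_nonneg)
    show "(p \<bullet> q) ^ (2 ^ 240 + 1) \<le> - 1 / 3" using X unfolding t_def .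
    show "\<bar>p \<bullet> q\<bar> \<le> 1" "\<bar>p \<bullet> r\<bar> \<le> 1" "\<bar>q \<bullet> r\<bar> \<le> 1" using S b by auto
    assume X: "p \<bullet> q \<le> - (1 - 1 / 1000)"
    show "0 \<le> 1 + p \<bullet> q + p \<bullet> r + q \<bullet> r" if "p \<bullet> r \<le> - (1 - 1 / 1000)"
      using near[OF S(2,3) neg[OF S(1)]] X that by (simp add: inner_commute)
    show "0 \<le> 1 + p \<bullet> q + p \<bullet> r + q \<bullet> r" if "q \<bullet> r \<le> - (1 - 1 / 1000)"
      using near[OF S(1,3) neg[OF S(2)]] X that by (simp add: inner_commute)
    show "\<bar>p \<bullet> r + q \<bullet> r\<bar> \<le> 3 * (1 + p \<bullet> q)"
      using far[OF S(1,3) neg[OF S(2)]] X by (simp add: inner_commute abs_le_iff)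
  qed
  have "0 \<le> 1 + (p \<bullet> q) ^ t + (p \<bullet> r) ^ t + (q \<bullet> r) ^ t"
  proof (rule ccontr)
    assume c: "\<not> ?thesis"
    then consider "(p \<bullet> q) ^ t \<le> - 1 / 3" | "(p \<bullet> r) ^ t \<le> - 1 / 3" | "(q \<bullet> r) ^ t \<le> - 1 / 3"
      by linarith
    then show False
    proof cases
      case 1 with aux[OF S] c show False by simp
    next
      case 2 with aux[of p r q] S c show False by (simp add: inner_commute)
    next
      case 3 with aux[of q r p] S c show False by (simp add: inner_commute)
    qed
  qed
  then show ?thesis unfolding t_def .
qed

section \<open>Matched orthonormal bases\<close>

text \<open>Parseval: the residual of the expansion is orthogonal to a spanning set, hence to
  itself.\<close>

lemma orthonormal_basis_inner:
  fixes e :: "'i \<Rightarrow> real ^ 'n"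
  assumes e: "orthonormal_basis I e" and I: "finite I"
  shows "(\<Sum>i\<in>I. (x \<bullet> e i) * (y \<bullet> e i)) = x \<bullet> y"
proof -
  define r where "r = x - (\<Sum>i\<in>I. (x \<bullet> e i) *\<^sub>R e i)"
  have "orthogonal r (e j)" if "j \<in> I" for j
  proof -
    have "(\<Sum>i\<in>I. (x \<bullet> e i) * (e i \<bullet> e j)) = (\<Sum>i\<in>I. if i = j then x \<bullet> e j else 0)"
      using e that by (intro sum.cong) (auto simp: orthonormal_basis_def)
    then show ?thesis
      using I that by (simp add: r_def orthogonal_def inner_diff_left inner_sum_left)
  qed
  then have "orthogonal r r"
    using e by (intro orthogonal_to_span[of r "e ` I"]) (auto simp: orthonormal_basis_def)
  then have "x = (\<Sum>i\<in>I. (x \<bullet> e i) *\<^sub>R e i)" by (simp add: r_def orthogonal_self)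
  then have "x \<bullet> y = (\<Sum>i\<in>I. (x \<bullet> e i) *\<^sub>R e i) \<bullet> y" by (rule arg_cong)
  also have "\<dots> = (\<Sum>i\<in>I. (x \<bullet> e i) * (y \<bullet> e i))"
    by (simp add: inner_sum_left inner_commute[of y])
  finally show ?thesis ..
qed

definition matched :: "nat \<Rightarrow> (nat \<Rightarrow> real ^ 'n) \<Rightarrow> (nat \<Rightarrow> real ^ 'n) \<Rightarrow> bool" where
  "matched k e f \<longleftrightarrow> (\<forall>i<2 ^ k. \<forall>j<2 ^ k. \<forall>l<2 ^ k. e i \<bullet> f j = e (xor i l) \<bullet> f (xor j l))"

lemma matched_shift:
  assumes "matched k e f" "i < 2 ^ k" "j < 2 ^ k" "m < 2 ^ k"
  shows "e i \<bullet> f (xor j m) = e (xor i m) \<bullet> f j"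
  using assms xor_less_power2[OF assms(3,4)] unfolding matched_def
  by (metis xor_xor_cancel(1))

lemma orthonormal_basis_xor:
  fixes j :: nat
  assumes "orthonormal_basis {..<2 ^ k} e" "j < 2 ^ k"
  shows "orthonormal_basis {..<2 ^ k} (\<lambda>m. e (xor j m))"
proof -
  have "(\<lambda>m. xor j m) ` {..<2 ^ k} = {..<2 ^ k}"
    using bij_betw_xor[OF assms(2)] by (simp add: bij_betw_def xor.commute)
  then have "(\<lambda>m. e (xor j m)) ` {..<2 ^ k} = e ` {..<2 ^ k}" by (metis image_image)
  moreover have "xor j m = xor j m' \<longleftrightarrow> m = m'" for m m' by (metis xor_xor_cancel(2))
  ultimately show ?thesis using assms by (simp add: orthonormal_basis_def xor_less_power2)
qed

text \<open>In the sum over \<open>m\<close> of the squared signed combination, Parseval turns the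
  four pure squares into 1 each, and the six cross terms pair up to give each of the three inner
  products with coefficient 4.\<close>

lemma signed_triangle:
  fixes e f g :: "nat \<Rightarrow> real ^ 'n"
  assumes basis: "orthonormal_basis {..<2 ^ k} e" "orthonormal_basis {..<2 ^ k} f" "orthonormal_basis {..<2 ^ k} g"
    and matched: "matched k e f" "matched k e g" "matched k f g"
    and ijl: "i < 2 ^ k" "j < 2 ^ k" "l < 2 ^ k"
    and s: "s * s = 1" "t * t = 1"
  shows "0 \<le> 1 + s * (e i \<bullet> g l) + t * (f j \<bullet> g l) + s * t * (e i \<bullet> f j)"
proof -
  \<comment> \<open>Translation moves the three labels to 0; matching then becomes the symmetry
    \<open>sym\<close>.\<close>
  define a b c where "a m = e (xor i m)" "b m = f (xor j m)" "c m = g (xor l m)" for m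
  note defs = this
  have sym: "a 0 \<bullet> c m = c 0 \<bullet> a m" "b 0 \<bullet> c m = c 0 \<bullet> b m" "a 0 \<bullet> b m = b 0 \<bullet> a m" if "m < 2 ^ k" for m
    using matched_shift matched ijl that by (auto simp: defs inner_commute)
  have oa: "orthonormal_basis {..<2 ^ k} a" and ob: "orthonormal_basis {..<2 ^ k} b"
    and oc: "orthonormal_basis {..<2 ^ k} c"
    unfolding defs using basis ijl by (auto intro: orthonormal_basis_xor)
  note parseval = orthonormal_basis_inner[OF oa finite_lessThan]
    orthonormal_basis_inner[OF ob finite_lessThan] orthonormal_basis_inner[OF oc finite_lessThan]
  have unit: "a 0 \<bullet> a 0 = 1" "b 0 \<bullet> b 0 = 1" "c 0 \<bullet> c 0 = 1"
    using oa ob oc by (auto simp: orthonormal_basis_def)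
  \<comment> \<open>Both sides are the same Kronecker delta, so a cross term can be summed in
    whichever basis suits Parseval.\<close>
  have eq: "c 0 \<bullet> c m = b 0 \<bullet> b m" if "m < 2 ^ k" for m
    using ob oc that by (auto simp: orthonormal_basis_def)
  have "0 \<le> (\<Sum>m<2 ^ k. (c 0 \<bullet> c m + s * (a 0 \<bullet> c m) + t * (b 0 \<bullet> c m) + s * t * (a 0 \<bullet> b m))\<^sup>2)"
    by (intro sum_nonneg) auto
  also have "\<dots> = (\<Sum>m<2 ^ k. (c 0 \<bullet> c m) * (c 0 \<bullet> c m) + (s * s) * ((a 0 \<bullet> c m) * (a 0 \<bullet> c m))
      + (t * t) * ((b 0 \<bullet> c m) * (b 0 \<bullet> c m)) + (s * s) * (t * t) * ((a 0 \<bullet> b m) * (a 0 \<bullet> b m))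
      + 2 * s * ((c 0 \<bullet> c m) * (a 0 \<bullet> c m)) + 2 * t * ((c 0 \<bullet> c m) * (b 0 \<bullet> c m))
      + 2 * s * t * ((b 0 \<bullet> b m) * (a 0 \<bullet> b m)) + 2 * s * t * ((a 0 \<bullet> c m) * (b 0 \<bullet> c m))
      + 2 * (s * s) * t * ((c 0 \<bullet> a m) * (b 0 \<bullet> a m)) + 2 * s * (t * t) * ((c 0 \<bullet> b m) * (a 0 \<bullet> b m)))"
    (is "_ = sum ?h _")
  proof (rule sum.cong[OF refl])
    fix m :: nat assume "m \<in> {..<2 ^ k}"
    then have m: "m < 2 ^ k" by simp
    show "(c 0 \<bullet> c m + s * (a 0 \<bullet> c m) + t * (b 0 \<bullet> c m) + s * t * (a 0 \<bullet> b m))\<^sup>2 = ?h m"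
      unfolding sym(1,2)[OF m, symmetric] sym(3)[OF m, symmetric] eq[OF m, symmetric]
      by (simp add: power2_eq_square algebra_simps)
  qed
  also have "\<dots> = 4 * (1 + s * (a 0 \<bullet> c 0) + t * (b 0 \<bullet> c 0) + s * t * (a 0 \<bullet> b 0))"
    by (simp only: sum.distrib flip: sum_distrib_left)
       (simp add: parseval unit s inner_commute[of "c 0" "a 0"] inner_commute[of "c 0" "b 0"]
         inner_commute[of "b 0" "a 0"] algebra_simps)
  finally show ?thesis by (simp add: defs)
qed

section \<open>Inner products of cube vectors as eighth-power correlations\<close>

definition overlap :: "nat \<Rightarrow> (nat \<Rightarrow> real ^ 'n) \<Rightarrow> (nat \<Rightarrow> real ^ 'n) \<Rightarrow> nat \<Rightarrow> real" where
  "overlap k e f m = \<bar>e 0 \<bullet> f m\<bar>"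

definition correlation :: "nat \<Rightarrow> (nat \<Rightarrow> real) \<Rightarrow> (nat \<Rightarrow> real) \<Rightarrow> nat \<Rightarrow> real" where
  "correlation k x y m = (\<Sum>i<2 ^ k. x i * y (xor i m)) / 2 ^ k"

text \<open>By matching, an inner product of basis vectors depends only on the difference
  \<open>m\<close> of the labels, so the double sum is grouped by \<open>m\<close>. The even
  exponent hides the absolute value in \<open>overlap\<close>.\<close>

lemma inner_cube_vector:
  assumes "matched k e f"
  shows "cube_vector k e x \<bullet> cube_vector k f y = corr {..<2 ^ k} (overlap k e f) (correlation k x y)"
proof -
  have "cube_vector k e x \<bullet> cube_vector k f y = (\<Sum>i<2 ^ k. \<Sum>j<2 ^ k. x i * y j * (e i \<bullet> f j) ^ 8) / 2 ^ k"
    by (subst sum.swap)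
       (simp add: cube_vector_def inner_sum_left inner_sum_right inner_tensor_power sum_distrib_left
         sum_divide_distrib mult_ac)
  also have "(\<Sum>i<2 ^ k. \<Sum>j<2 ^ k. x i * y j * (e i \<bullet> f j) ^ 8)
     = (\<Sum>i<2 ^ k. \<Sum>m<2 ^ k. x i * y (xor i m) * (e 0 \<bullet> f m) ^ 8)"
  proof (rule sum.cong[OF refl])
    fix i :: nat assume "i \<in> {..<2 ^ k}"
    then have i: "i < 2 ^ k" by simp
    have "(\<Sum>j<2 ^ k. x i * y j * (e i \<bullet> f j) ^ 8) = (\<Sum>m<2 ^ k. x i * y (xor m i) * (e i \<bullet> f (xor m i)) ^ 8)"
      by (rule sum_xor[OF i, symmetric])
    also have "\<dots> = (\<Sum>m<2 ^ k. x i * y (xor i m) * (e 0 \<bullet> f m) ^ 8)"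
      using matched_shift[OF assms i _ i] by (intro sum.cong) (auto simp: xor.commute)
    finally show "(\<Sum>j<2 ^ k. x i * y j * (e i \<bullet> f j) ^ 8) = (\<Sum>m<2 ^ k. x i * y (xor i m) * (e 0 \<bullet> f m) ^ 8)" .
  qed
  also have "\<dots> = (\<Sum>m<2 ^ k. \<Sum>i<2 ^ k. x i * y (xor i m) * (e 0 \<bullet> f m) ^ 8)" by (rule sum.swap)
  also have "\<dots> / 2 ^ k = corr {..<2 ^ k} (overlap k e f) (correlation k x y)"
    by (simp add: corr_def overlap_def correlation_def sum_divide_distrib sum_distrib_left sum_distrib_right mult_ac)
  finally show ?thesis .
qed

lemma kernel_overlap:
  assumes "orthonormal_basis {..<2 ^ k} e" "orthonormal_basis {..<2 ^ k} f"
    and X: "x \<in> {..<2 ^ k} \<rightarrow> {-1, 1}" "y \<in> {..<2 ^ k} \<rightarrow> {-1, 1}"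
  shows "kernel {..<2 ^ k} (overlap k e f) (correlation k x y)"
proof -
  have "(\<Sum>m<2 ^ k. (e 0 \<bullet> f m)\<^sup>2) = 1"
    using orthonormal_basis_inner[OF assms(2), of "e 0" "e 0"] assms(1)
    by (simp add: orthonormal_basis_def power2_eq_square)
  moreover have "\<bar>correlation k x y m\<bar> \<le> 1" if m: "m < 2 ^ k" for m
  proof -
    have "\<bar>\<Sum>i<2 ^ k. x i * y (xor i m)\<bar> \<le> (\<Sum>i<2 ^ k. \<bar>x i * y (xor i m)\<bar>)" by (rule sum_abs)
    also have "\<dots> \<le> (\<Sum>i<(2::nat) ^ k. 1)"
    proof (rule sum_mono)
      fix i :: nat assume i: "i \<in> {..<2 ^ k}"
      then have "x i \<in> {-1, 1}" "y (xor i m) \<in> {-1, 1}" using X m by (auto simp: xor_less_power2 Pi_iff)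
      then show "\<bar>x i * y (xor i m)\<bar> \<le> 1" by auto
    qed
    finally show ?thesis by (simp add: correlation_def)
  qed
  ultimately show ?thesis by (simp add: kernel_def overlap_def)
qed

text \<open>The four sign choices in \<open>signed_triangle\<close>, at the labels 0,
  \<open>xor p q\<close> and \<open>p\<close>, give the triangle inequalities for absolute
  values.\<close>

lemma cube_triangle_overlap:
  assumes basis: "orthonormal_basis {..<2 ^ k} e" "orthonormal_basis {..<2 ^ k} f" "orthonormal_basis {..<2 ^ k} g"
    and matched: "matched k e f" "matched k e g" "matched k f g"
  shows "cube_triangle k (overlap k e g) (overlap k f g) (overlap k e f)"
  unfolding cube_triangle_def
proof (intro allI impI)
  fix p q :: nat assume pq: "p < 2 ^ k" "q < 2 ^ k"
  let ?r = "xor p q"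
  have r: "?r < 2 ^ k" using pq by (rule xor_less_power2)
  have fg: "f 0 \<bullet> g q = f ?r \<bullet> g p"
    using matched_shift[OF matched(3) _ pq(1) r, of 0] by simp
  note S = signed_triangle[OF basis matched _ r pq(1), of 0, folded fg]
  show "overlap k e g p + overlap k f g q \<le> 1 + overlap k e f ?r \<and>
        overlap k e g p + overlap k e f ?r \<le> 1 + overlap k f g q \<and>
        overlap k f g q + overlap k e f ?r \<le> 1 + overlap k e g p"
    using S[of 1 1] S[of 1 "-1"] S[of "-1" 1] S[of "-1" "-1"] unfolding overlap_def by simp linarith
qed

text \<open>For three signs the inequalities hold pointwise, and averaging preserves them; shifting
  the summation variable by \<open>xor p q\<close> makes all three averages run over the same
  triples of signs.\<close>

lemma cube_triangle_correlation:
  assumes X: "x \<in> {..<2 ^ k} \<rightarrow> {-1, 1}" "y \<in> {..<2 ^ k} \<rightarrow> {-1, 1}" "z \<in> {..<2 ^ k} \<rightarrow> {-1, 1}"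
  shows "cube_triangle k (correlation k x z) (correlation k y z) (correlation k x y)"
  unfolding cube_triangle_def
proof (intro allI impI)
  fix p q :: nat assume pq: "p < 2 ^ k" "q < 2 ^ k"
  let ?r = "xor p q"
  have r: "?r < 2 ^ k" using pq by (rule xor_less_power2)
  have yz: "(\<Sum>i<2 ^ k. y i * z (xor i q)) = (\<Sum>i<2 ^ k. y (xor i ?r) * z (xor i p))"
    by (subst sum_xor[OF r, symmetric]) (simp flip: xor.assoc)
  have pt: "x i * z (xor i p) + y (xor i ?r) * z (xor i p) \<le> 1 + x i * y (xor i ?r) \<and>
      x i * z (xor i p) + x i * y (xor i ?r) \<le> 1 + y (xor i ?r) * z (xor i p) \<and>
      y (xor i ?r) * z (xor i p) + x i * y (xor i ?r) \<le> 1 + x i * z (xor i p)" if "i < 2 ^ k" for i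
  proof -
    have "x i \<in> {-1, 1}" "y (xor i ?r) \<in> {-1, 1}" "z (xor i p) \<in> {-1, 1}"
      using X that r pq by (auto simp: xor_less_power2 Pi_iff)
    then show ?thesis by auto
  qed
  have avg: "(\<Sum>i<2 ^ k. f i) / 2 ^ k + (\<Sum>i<2 ^ k. g i) / 2 ^ k \<le> 1 + (\<Sum>i<2 ^ k. h i) / 2 ^ k"
    if "\<And>i. i < 2 ^ k \<Longrightarrow> f i + g i \<le> 1 + h i" for f g h :: "nat \<Rightarrow> real"
  proof -
    have "(\<Sum>i<2 ^ k. f i + g i) \<le> (\<Sum>i<2 ^ k. 1 + h i)" using that by (intro sum_mono) auto
    then have "((\<Sum>i<2 ^ k. f i) + (\<Sum>i<2 ^ k. g i)) / 2 ^ k \<le> (2 ^ k + (\<Sum>i<2 ^ k. h i)) / 2 ^ k"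
      by (intro divide_right_mono) (simp_all add: sum.distrib)
    then show ?thesis by (simp add: add_divide_distrib)
  qed
  show "correlation k x z p + correlation k y z q \<le> 1 + correlation k x y ?r \<and>
        correlation k x z p + correlation k x y ?r \<le> 1 + correlation k y z q \<and>
        correlation k y z q + correlation k x y ?r \<le> 1 + correlation k x z p"
    unfolding correlation_def yz by (intro conjI avg) (use pt in auto)
qed

lemma norm_cube_vector:
  assumes e: "orthonormal_basis {..<2 ^ k} e" and m: "matched k e e" and X: "x \<in> {..<2 ^ k} \<rightarrow> {-1, 1}"
  shows "norm (cube_vector k e x) = 1"
proof -
  have "x i * x i = 1" if "i < 2 ^ k" for i
  proof -
    have "x i \<in> {-1, 1}" using X that by (auto simp: Pi_iff)
    then show ?thesis by auto
  qed
  then have "correlation k x x 0 = 1" by (simp add: correlation_def)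
  moreover have "overlap k e e i = (if i = 0 then 1 else 0)" if "i < 2 ^ k" for i
    using e that by (auto simp: overlap_def orthonormal_basis_def)
  then have "corr {..<2 ^ k} (overlap k e e) (correlation k x x)
    = (\<Sum>i<2 ^ k :: nat. if i = 0 then correlation k x x 0 else 0)"
    unfolding corr_def by (intro sum.cong) auto
  ultimately have "cube_vector k e x \<bullet> cube_vector k e x = 1"
    by (simp add: inner_cube_vector[OF m])
  then show ?thesis by (simp add: norm_eq_1)
qed

section \<open>The negative-type inequality for tensor powers\<close>

lemma cube_vector_negative_type:
  fixes b :: "'v \<Rightarrow> nat \<Rightarrow> real ^ 'n" and k :: nat and V :: "'v set"
  defines "S \<equiv> {cube_vector k (b v) x |v x. v \<in> V \<and> x \<in> {..<2 ^ k} \<rightarrow> {-1, 1}}"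
  assumes basis: "\<And>v. v \<in> V \<Longrightarrow> orthonormal_basis {..<2 ^ k} (b v)"
    and matched: "\<And>v w. v \<in> V \<Longrightarrow> w \<in> V \<Longrightarrow> matched k (b v) (b w)"
    and S: "p \<in> S" "q \<in> S" "r \<in> S"
  shows "(p \<bullet> q) ^ (2 ^ 240 + 1) + (q \<bullet> r) ^ (2 ^ 240 + 1) \<le> 1 + (p \<bullet> r) ^ (2 ^ 240 + 1)"
proof -
  have unit: "norm p = 1" if "p \<in> S" for p
    using that basis matched by (auto simp: S_def norm_cube_vector)
  have neg: "- p \<in> S" if p: "p \<in> S" for p
  proof -
    obtain v x where v: "v \<in> V" "x \<in> {..<2 ^ k} \<rightarrow> {-1, 1}" "p = cube_vector k (b v) x"
      using p by (auto simp: S_def)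
    have "- p = cube_vector k (b v) (\<lambda>i. - x i)"
      unfolding v(3) by (simp add: cube_vector_def sum_negf)
    moreover have "(\<lambda>i. - x i) \<in> {..<2 ^ k} \<rightarrow> {-1, 1}"
      using v(2) by (fastforce simp: Pi_iff)
    ultimately show ?thesis using v(1) by (auto simp: S_def)
  qed
  have *: "(p \<bullet> r \<ge> 1 - 1 / 1000 \<longrightarrow> q \<bullet> r \<ge> 1 - 1 / 1000 \<longrightarrow> p \<bullet> r + q \<bullet> r \<le> 1 + p \<bullet> q) \<and>
      (p \<bullet> r \<ge> 1 - 1 / 1000 \<longrightarrow> \<bar>q \<bullet> r - p \<bullet> q\<bar> \<le> 3 * (1 - p \<bullet> r))"
    if S: "p \<in> S" "q \<in> S" "r \<in> S" for p q r
  proof -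
    obtain u x where u: "u \<in> V" "x \<in> {..<2 ^ k} \<rightarrow> {-1, 1}" "p = cube_vector k (b u) x"
      using S by (auto simp: S_def)
    obtain v y where v: "v \<in> V" "y \<in> {..<2 ^ k} \<rightarrow> {-1, 1}" "q = cube_vector k (b v) y"
      using S by (auto simp: S_def)
    obtain w z where w: "w \<in> V" "z \<in> {..<2 ^ k} \<rightarrow> {-1, 1}" "r = cube_vector k (b w) z"
      using S by (auto simp: S_def)
    note K = kernel_overlap[OF basis[OF u(1)] basis[OF w(1)] u(2) w(2)]
      kernel_overlap[OF basis[OF v(1)] basis[OF w(1)] v(2) w(2)]
      kernel_overlap[OF basis[OF u(1)] basis[OF v(1)] u(2) v(2)]
      cube_triangle_overlap[OF basis[OF u(1)] basis[OF v(1)] basis[OF w(1)]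
        matched[OF u(1) v(1)] matched[OF u(1) w(1)] matched[OF v(1) w(1)]]
      cube_triangle_correlation[OF u(2) v(2) w(2)]
    show ?thesis
      unfolding u(3) v(3) w(3)
      using corr_near[OF K] corr_far[OF K] u(1) v(1) w(1) matched by (simp add: inner_cube_vector)
  qed
  define t :: nat where "t = 2 ^ 240 + 1"
  have t: "odd t" by (simp add: t_def)
  \<comment> \<open>Negating the middle vector \<open>q\<close> flips exactly the two terms that
    belong on the other side, because \<open>t\<close> is odd.\<close>
  have "0 \<le> 1 + (p \<bullet> r) ^ t + (p \<bullet> - q) ^ t + (r \<bullet> - q) ^ t"
    unfolding t_def
  proof (rule odd_power_negative_type[of S])
    show "p \<in> S" "r \<in> S" "- q \<in> S" using S neg by auto
  qed (use unit neg * in auto)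
  then have "(p \<bullet> q) ^ t + (q \<bullet> r) ^ t \<le> 1 + (p \<bullet> r) ^ t"
    using t by (simp add: inner_commute)
  then show ?thesis unfolding t_def .
qed

text \<open>Squared distances of unit vectors are \<open>2 - 2 * c\<close> with \<open>c\<close> the
  inner product, and tensoring raises \<open>c\<close> to the power \<open>2 ^ 240 + 1\<close>; this
  reduces the claim to \<open>cube_vector_negative_type\<close>.\<close>

theorem theorem5p6:
  fixes k :: nat and V :: "'v set" and b :: "'v \<Rightarrow> nat \<Rightarrow> real ^ 'n"
  assumes dim: "CARD('n) = 2 ^ k"
    and t: "CARD('t::finite) = 2 ^ 240 + 1"
    and fin: "finite V"
    and basis: "\<And>v. v \<in> V \<Longrightarrow> orthonormal_basis {..<2 ^ k} (b v)"
    and triangle: "\<And>u v w i j l. \<lbrakk>u \<in> V; v \<in> V; w \<in> V; i < 2 ^ k; j < 2 ^ k; l < 2 ^ k\<rbrakk>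
      \<Longrightarrow> 1 + b u i \<bullet> b v j \<ge> b u i \<bullet> b w l + b v j \<bullet> b w l"
    and matching: "\<And>v w i j l. \<lbrakk>v \<in> V; w \<in> V; i < 2 ^ k; j < 2 ^ k; l < 2 ^ k\<rbrakk>
      \<Longrightarrow> b v i \<bullet> b w j = b v (xor i l) \<bullet> b w (xor j l)"
  shows "let P = (\<lambda>v x. tensor_power (cube_vector k (b v) x) :: real ^ ('t \<Rightarrow> 8 \<Rightarrow> 'n));
             X = {..<2 ^ k} \<rightarrow> {-1, 1}
         in (\<forall>v\<in>V. \<forall>x\<in>X. norm (P v x) = 1) \<and>
            (\<forall>u\<in>V. \<forall>v\<in>V. \<forall>w\<in>V. \<forall>x\<in>X. \<forall>y\<in>X. \<forall>z\<in>X.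
               (norm (P u x - P v y))\<^sup>2 + (norm (P v y - P w z))\<^sup>2 \<ge> (norm (P u x - P w z))\<^sup>2)"
proof -
  define X :: "(nat \<Rightarrow> real) set" where "X = {..<2 ^ k} \<rightarrow> {-1, 1}"
  define P where "P v x = (tensor_power (cube_vector k (b v) x) :: real ^ ('t \<Rightarrow> 8 \<Rightarrow> 'n))" for v x
  have matched: "matched k (b v) (b w)" if "v \<in> V" "w \<in> V" for v w
    using matching[OF that] by (simp add: matched_def)
  have P: "P u x \<bullet> P v y = (cube_vector k (b u) x \<bullet> cube_vector k (b v) y) ^ (2 ^ 240 + 1)" for u v x y
    unfolding P_def inner_tensor_power t ..
  have unit: "norm (P v x) = 1" if "v \<in> V" "x \<in> X" for v x
    using norm_cube_vector[OF basis matched] that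
    by (simp only: norm_eq_1 P power_one X_def)
  have dist: "(norm (P u x - P v y))\<^sup>2 = 2 - 2 * (P u x \<bullet> P v y)"
    if "u \<in> V" "x \<in> X" "v \<in> V" "y \<in> X" for u v x y
    using unit[of u x] unit[of v y] that
    by (simp add: power2_norm_eq_inner norm_eq_1 inner_diff_left inner_diff_right inner_commute)
  have le: "P u x \<bullet> P v y + P v y \<bullet> P w z \<le> 1 + P u x \<bullet> P w z"
    if "u \<in> V" "v \<in> V" "w \<in> V" "x \<in> X" "y \<in> X" "z \<in> X" for u v w x y z
    unfolding P using that by (intro cube_vector_negative_type[where V = V and k = k and b = b] basis matched) (auto simp: X_def)
  have "(norm (P u x - P w z))\<^sup>2 \<le> (norm (P u x - P v y))\<^sup>2 + (norm (P v y - P w z))\<^sup>2"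
    if "u \<in> V" "v \<in> V" "w \<in> V" "x \<in> X" "y \<in> X" "z \<in> X" for u v w x y z
    using le[OF that] by (simp add: dist that)
  with unit show ?thesis
    unfolding Let_def P_def[symmetric] X_def[symmetric] by blast
qed

end
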